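(* Let $A$ be a unital separable $C^*$-algebra and let $S\subset A$ be an operator system with $C^*(S)=A$. If every pure state of $A$ is maximal in the dilation order $\preceq_{\mathrm D}$ associated with $(S,A)$, then every state of $A$ is maximal in the integral subdivision relation $\preceq_{\mathrm{ISD}}$ associated with $(S,A)$.
   Context: An operator system in $A$ is a unital self-adjoint linear subspace of $A$; $C^*(S)$ is the $C^*$-subalgebra generated by $S$. $\mathcal E(A)$ is the state space of $A$ with the weak-$*$ topology. UCP means unital completely positive. For $\varphi\in\mathcal E(A)$, $(\pi_\varphi,H_\varphi,\xi_\varphi)$ denotes its GNS representation. Dilation order: $\varphi\preceq_{\mathrm D}\psi$ if there exists a UCP map $\Phi:A\to B(H_\varphi)$ with $\Phi(s)=\pi_\varphi(s)$ for all $s\in S$ and $\psi(a)=\langle\Phi(a)\xi_\varphi,\xi_\varphi\rangle$ for all $a\in A$. Barycenter: for a Borel probability measure $\mu$ on $\mathcal E(A)$, $\mathfrak b(\mu)(a)=\int_{\mathcal E(A)}\alpha(a)\,d\mu(\alpha)$, $a\in A$. $\bar\mu$ denotes the completion of $\mu$. Integral subdivision relation: $\varphi\preceq_{\mathrm{ISD}}\psi$ if for every Borel probability measure $\mu$ on $\mathcal E(A)$ with $\mathfrak b(\mu)=\varphi$ there is a family of states $\alpha\mapsto\psi_\alpha\in\mathcal E(A)$ ($\alpha\in\mathcal E(A)$) such that $\alpha\mapsto\psi_\alpha(a)$ is $\bar\mu$-measurable for every $a\in A$, $\alpha\preceq_{\mathrm D}\psi_\alpha$ for $\bar\mu$-almost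 every $\alpha$, and $\psi(a)=\int_{\mathcal E(A)}\psi_\alpha(a)\,d\bar\mu(\alpha)$ for all $a\in A$. A state $\varphi$ is maximal for a relation $\preceq$ on $\mathcal E(A)$ if $\varphi\preceq\psi$ implies $\psi=\varphi$ for every $\psi\in\mathcal E(A)$. *)

theory Defs
  imports "HOL-Probability.Probability"
begin

section \<open>Unital C*-algebras and operator systems\<close>

text \<open>The real scaling of \<^class>\<open>real_normed_algebra\<close> is the restriction of the complex one.
  The base is \<^class>\<open>monoid_mult\<close> rather than \<^class>\<open>real_normed_algebra_1\<close>, so
  that the zero algebra is not excluded.\<close>

class cstar_algebra = real_normed_algebra + banach + monoid_mult +
  fixes scaleC :: "complex \<Rightarrow> 'a \<Rightarrow> 'a"  (infixr \<open>*\<^sub>C\<close> 75)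
    and star :: "'a \<Rightarrow> 'a"
  assumes scaleC_add_right: "c *\<^sub>C (x + y) = c *\<^sub>C x + c *\<^sub>C y"
    and scaleC_add_left: "(c + d) *\<^sub>C x = c *\<^sub>C x + d *\<^sub>C x"
    and scaleC_scaleC: "c *\<^sub>C d *\<^sub>C x = (c * d) *\<^sub>C x"
    and scaleC_one: "1 *\<^sub>C x = x"
    and scaleR_scaleC: "r *\<^sub>R x = complex_of_real r *\<^sub>C x"
    and mult_scaleC_left: "(c *\<^sub>C x) * y = c *\<^sub>C (x * y)"
    and mult_scaleC_right: "x * (c *\<^sub>C y) = c *\<^sub>C (x * y)"
    and norm_scaleC: "norm (c *\<^sub>C x) = cmod c * norm x"
    and star_add: "star (x + y) = star x + star y"
    and star_scaleC: "star (c *\<^sub>C x) = cnj c *\<^sub>C star x"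
    and star_mult: "star (x * y) = star y * star x"
    and star_star: "star (star x) = x"
    and cstar_identity: "norm (star x * x) = (norm x)\<^sup>2"

definition cstar_subalgebra :: "'a::cstar_algebra set \<Rightarrow> bool" where
  "cstar_subalgebra B \<longleftrightarrow> closed B \<and> 0 \<in> B \<and>
     (\<forall>x\<in>B. \<forall>y\<in>B. x + y \<in> B) \<and> (\<forall>c. \<forall>x\<in>B. c *\<^sub>C x \<in> B) \<and>
     (\<forall>x\<in>B. \<forall>y\<in>B. x * y \<in> B) \<and> (\<forall>x\<in>B. star x \<in> B)"

definition cstar_generated :: "'a::cstar_algebra set \<Rightarrow> 'a set" where
  "cstar_generated S = cstar_subalgebra hull S"

definition operator_system :: "'a::cstar_algebra set \<Rightarrow> bool" where
  "operator_system S \<longleftrightarrow> 1 \<in> S \<and> (\<forall>x\<in>S. \<forall>y\<in>S. x + y \<in> S) \<and>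
     (\<forall>c. \<forall>x\<in>S. c *\<^sub>C x \<in> S) \<and> (\<forall>x\<in>S. star x \<in> S)"

section \<open>States\<close>

definition states :: "('a::cstar_algebra \<Rightarrow> complex) set" where
  "states = {\<phi>. bounded_linear \<phi> \<and> (\<forall>c a. \<phi> (c *\<^sub>C a) = c * \<phi> a) \<and>
     (\<forall>a. \<phi> (star a * a) \<in> \<real>\<^sub>\<ge>\<^sub>0) \<and> \<phi> 1 = 1}"

definition pure_state :: "('a::cstar_algebra \<Rightarrow> complex) \<Rightarrow> bool" where
  "pure_state \<phi> \<longleftrightarrow> \<phi> \<in> states \<and>
     (\<forall>\<psi>\<in>states. \<forall>\<theta>\<in>states. \<forall>t::real. 0 < t \<and> t < 1 \<and>
        (\<forall>a. \<phi> a = complex_of_real (1 - t) * \<psi> a + complex_of_real t * \<theta> a) \<longrightarrow>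
        \<psi> = \<phi> \<and> \<theta> = \<phi>)"

definition maximal_state ::
  "(('a::cstar_algebra \<Rightarrow> complex) \<Rightarrow> ('a \<Rightarrow> complex) \<Rightarrow> bool) \<Rightarrow> ('a \<Rightarrow> complex) \<Rightarrow> bool" where
  "maximal_state R \<phi> \<longleftrightarrow> \<phi> \<in> states \<and> (\<forall>\<psi>\<in>states. R \<phi> \<psi> \<longrightarrow> \<psi> = \<phi>)"

section \<open>Hilbert spaces on explicit carriers and completely positive maps\<close>

text \<open>The space \<open>H\<^sub>\<phi>\<close> depends on the state \<open>\<phi>\<close>, so Hilbert spaces are given by
  explicit carriers. The inner product is linear in its first argument.\<close>

record 'h hilbert_data =
  hcarrier :: "'h set"
  hadd :: "'h \<Rightarrow> 'h \<Rightarrow> 'h"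
  hscale :: "complex \<Rightarrow> 'h \<Rightarrow> 'h"
  hinner :: "'h \<Rightarrow> 'h \<Rightarrow> complex"

definition hnorm :: "'h hilbert_data \<Rightarrow> 'h \<Rightarrow> real" where
  "hnorm H v = sqrt (Re (hinner H v v))"

text \<open>Membership in \<open>B(H)\<close>; the values of an operator outside the carrier are irrelevant.\<close>

definition bounded_operator :: "'h hilbert_data \<Rightarrow> ('h \<Rightarrow> 'h) \<Rightarrow> bool" where
  "bounded_operator H T \<longleftrightarrow>
     (\<forall>v\<in>hcarrier H. T v \<in> hcarrier H) \<and>
     (\<forall>v\<in>hcarrier H. \<forall>w\<in>hcarrier H. T (hadd H v w) = hadd H (T v) (T w)) \<and>
     (\<forall>c. \<forall>v\<in>hcarrier H. T (hscale H c v) = hscale H c (T v)) \<and>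
     (\<exists>K. \<forall>v\<in>hcarrier H. hnorm H (T v) \<le> K * hnorm H v)"

text \<open>Matrices in \<open>M\<^sub>n(A)\<close> and in \<open>M\<^sub>n(B(H)) = B(H\<^sup>n)\<close> are families indexed by
  \<open>i, j < n\<close>. A positive element of \<open>M\<^sub>n(A)\<close> is one of the form \<open>X\<^sup>* X\<close>.\<close>

definition mat_positive :: "nat \<Rightarrow> (nat \<Rightarrow> nat \<Rightarrow> 'a::cstar_algebra) \<Rightarrow> bool" where
  "mat_positive n M \<longleftrightarrow>
     (\<exists>X. \<forall>i<n. \<forall>j<n. M i j = (\<Sum>k<n. star (X k i) * X k j))"

definition op_mat_positive ::
  "'h hilbert_data \<Rightarrow> nat \<Rightarrow> (nat \<Rightarrow> nat \<Rightarrow> 'h \<Rightarrow> 'h) \<Rightarrow> bool" where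
  "op_mat_positive H n T \<longleftrightarrow>
     (\<forall>v. (\<forall>i<n. v i \<in> hcarrier H) \<longrightarrow>
        (\<Sum>i<n. \<Sum>j<n. hinner H (T i j (v j)) (v i)) \<in> \<real>\<^sub>\<ge>\<^sub>0)"

definition completely_positive ::
  "'h hilbert_data \<Rightarrow> ('a::cstar_algebra \<Rightarrow> 'h \<Rightarrow> 'h) \<Rightarrow> bool" where
  "completely_positive H \<Phi> \<longleftrightarrow>
     (\<forall>n M. mat_positive n M \<longrightarrow> op_mat_positive H n (\<lambda>i j. \<Phi> (M i j)))"

definition ucp :: "'h hilbert_data \<Rightarrow> ('a::cstar_algebra \<Rightarrow> 'h \<Rightarrow> 'h) \<Rightarrow> bool" where
  "ucp H \<Phi> \<longleftrightarrow>
     (\<forall>a. bounded_operator H (\<Phi> a)) \<and>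
     (\<forall>a b. \<forall>v\<in>hcarrier H. \<Phi> (a + b) v = hadd H (\<Phi> a v) (\<Phi> b v)) \<and>
     (\<forall>c a. \<forall>v\<in>hcarrier H. \<Phi> (c *\<^sub>C a) v = hscale H c (\<Phi> a v)) \<and>
     (\<forall>v\<in>hcarrier H. \<Phi> 1 v = v) \<and>
     completely_positive H \<Phi>"

section \<open>The GNS representation\<close>

text \<open>\<open>H\<^sub>\<phi>\<close> is the completion of \<open>A / N\<^sub>\<phi>\<close> with \<open>N\<^sub>\<phi> = {a. \<phi> (a\<^sup>* a) = 0}\<close> and
  \<open>\<langle>a, b\<rangle> = \<phi> (b\<^sup>* a)\<close>, realised as the Cauchy sequences in \<open>A\<close> for the seminorm
  \<open>\<parallel>a\<parallel>\<^sub>\<phi> = \<phi> (a\<^sup>* a)\<^sup>1\<^sup>/\<^sup>2\<close> modulo those of seminorm distance tending to \<open>0\<close>. Passing from \<open>A\<close> to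
  \<open>A / N\<^sub>\<phi>\<close> first is unnecessary, since this is absorbed in the second quotient.
  The operations are defined on representatives.\<close>

definition gns_seminorm :: "('a::cstar_algebra \<Rightarrow> complex) \<Rightarrow> 'a \<Rightarrow> real" where
  "gns_seminorm \<phi> a = sqrt (Re (\<phi> (star a * a)))"

definition gns_Cauchy :: "('a::cstar_algebra \<Rightarrow> complex) \<Rightarrow> (nat \<Rightarrow> 'a) set" where
  "gns_Cauchy \<phi> = {x. \<forall>e>0. \<exists>N. \<forall>m\<ge>N. \<forall>n\<ge>N. gns_seminorm \<phi> (x m - x n) < e}"

definition gns_rel :: "('a::cstar_algebra \<Rightarrow> complex) \<Rightarrow> ((nat \<Rightarrow> 'a) \<times> (nat \<Rightarrow> 'a)) set" where
  "gns_rel \<phi> = {(x, y). x \<in> gns_Cauchy \<phi> \<and> y \<in> gns_Cauchy \<phi> \<and>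
     (\<lambda>n. gns_seminorm \<phi> (x n - y n)) \<longlonglongrightarrow> 0}"

definition gns_class :: "('a::cstar_algebra \<Rightarrow> complex) \<Rightarrow> (nat \<Rightarrow> 'a) \<Rightarrow> (nat \<Rightarrow> 'a) set" where
  "gns_class \<phi> x = gns_rel \<phi> `` {x}"

definition gns_space :: "('a::cstar_algebra \<Rightarrow> complex) \<Rightarrow> (nat \<Rightarrow> 'a) set hilbert_data" where
  "gns_space \<phi> =
     \<lparr>hcarrier = gns_Cauchy \<phi> // gns_rel \<phi>,
      hadd = (\<lambda>v w. \<Union>x\<in>v. \<Union>y\<in>w. gns_class \<phi> (\<lambda>n. x n + y n)),
      hscale = (\<lambda>c v. \<Union>x\<in>v. gns_class \<phi> (\<lambda>n. c *\<^sub>C x n)),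
      hinner = (\<lambda>v w. the_elem (\<Union>x\<in>v. \<Union>y\<in>w. {lim (\<lambda>n. \<phi> (star (y n) * x n))}))\<rparr>"

definition gns_rep ::
  "('a::cstar_algebra \<Rightarrow> complex) \<Rightarrow> 'a \<Rightarrow> (nat \<Rightarrow> 'a) set \<Rightarrow> (nat \<Rightarrow> 'a) set" where
  "gns_rep \<phi> a v = (\<Union>x\<in>v. gns_class \<phi> (\<lambda>n. a * x n))"

definition gns_vector :: "('a::cstar_algebra \<Rightarrow> complex) \<Rightarrow> (nat \<Rightarrow> 'a) set" where
  "gns_vector \<phi> = gns_class \<phi> (\<lambda>n. 1)"

section \<open>The dilation order and the integral subdivision relation\<close>

definition dilation_le ::
  "'a::cstar_algebra set \<Rightarrow> ('a \<Rightarrow> complex) \<Rightarrow> ('a \<Rightarrow> complex) \<Rightarrow> bool" where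
  "dilation_le S \<phi> \<psi> \<longleftrightarrow>
     (\<exists>\<Phi>. ucp (gns_space \<phi>) \<Phi> \<and>
        (\<forall>s\<in>S. \<forall>v\<in>hcarrier (gns_space \<phi>). \<Phi> s v = gns_rep \<phi> s v) \<and>
        (\<forall>a. \<psi> a = hinner (gns_space \<phi>) (\<Phi> a (gns_vector \<phi>)) (gns_vector \<phi>)))"

text \<open>The topology of the type \<^typ>\<open>'a \<Rightarrow> complex\<close> is the product topology, that is, pointwise
  convergence; it induces the weak-* topology on the state space, whose Borel sets
  are therefore the traces of the Borel sets of the function space.\<close>

definition state_borel :: "('a::cstar_algebra \<Rightarrow> complex) measure" where
  "state_borel = restrict_space borel states"

definition borel_prob_on_states :: "('a::cstar_algebra \<Rightarrow> complex) measure \<Rightarrow> bool" where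
  "borel_prob_on_states \<mu> \<longleftrightarrow> prob_space \<mu> \<and> sets \<mu> = sets state_borel"

definition barycenter :: "('a::cstar_algebra \<Rightarrow> complex) measure \<Rightarrow> 'a \<Rightarrow> complex" where
  "barycenter \<mu> a = (\<integral>\<alpha>. \<alpha> a \<partial>\<mu>)"

definition isd_le ::
  "'a::cstar_algebra set \<Rightarrow> ('a \<Rightarrow> complex) \<Rightarrow> ('a \<Rightarrow> complex) \<Rightarrow> bool" where
  "isd_le S \<phi> \<psi> \<longleftrightarrow>
     (\<forall>\<mu>. borel_prob_on_states \<mu> \<and> barycenter \<mu> = \<phi> \<longrightarrow>
        (\<exists>\<Psi>. (\<forall>\<alpha>\<in>states. \<Psi> \<alpha> \<in> states) \<and>
           (\<forall>a. (\<lambda>\<alpha>. \<Psi> \<alpha> a) \<in> borel_measurable (completion \<mu>)) \<and>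
           (AE \<alpha> in completion \<mu>. dilation_le S \<alpha> (\<Psi> \<alpha>)) \<and>
           (\<forall>a. \<psi> a = (\<integral>\<alpha>. \<Psi> \<alpha> a \<partial>completion \<mu>))))"

end

theory Submission
  imports Defs
begin

text \<open>If \<open>\<mu>\<close> represents \<open>\<phi>\<close> and is concentrated on pure states, then maximality of pure states
  in the dilation order forces \<open>\<psi>\<^sub>\<alpha> = \<alpha>\<close> for almost every \<open>\<alpha>\<close>, so \<open>\<psi> = \<phi>\<close>. Such a \<open>\<mu>\<close> is
  given by Choquet's theorem, which is obtained here without the Hahn--Banach and Riesz
  representation theorems. Let \<open>e\<^sub>k\<close> be affine coordinates on the compact metrizable state
  space and \<open>f = \<Sum>\<^sub>k 2\<^sup>-\<^sup>k e\<^sub>k\<^sup>2\<close>, which is strictly convex. Nearly minimise the penalised functional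
  \<open>N \<Sum>\<^bsub>k<N\<^esub> (p(e\<^sub>k) - e\<^sub>k(\<phi>))\<^sup>2 - p(f)\<close> over discrete probability measures \<open>p\<close>. The first order
  condition at a near minimiser \<open>p\<^sub>N\<close> is an affine function \<open>h\<^sub>N\<close> with \<open>f \<le> h\<^sub>N + 5 / (N + 1)\<close> and
  \<open>h\<^sub>N(\<phi>) \<le> p\<^sub>N(f)\<close>. A weak limit \<open>\<mu>\<close> of the \<open>p\<^sub>N\<close> represents \<open>\<phi>\<close>, and \<open>\<integral>(h\<^sub>N - f) d\<mu> \<rightarrow> 0\<close> along a
  subsequence; a point where \<open>h\<^sub>N - f \<rightarrow> 0\<close> is extreme by strict convexity of \<open>f\<close>. The weak
  limit comes from Helly's theorem on the real line, since a compact metrizable space is a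
  continuous image of a compact set of reals.\<close>

section \<open>Compact metrizable spaces as images of compact sets of reals\<close>

text \<open>The digits are floor(2^(i+1) y) mod 2. Since halving floor(2^(n+1) y) with remainder
  gives floor(2^n y), the first n weighted digits add up to floor(2^n y) / 2^n, which is within 2^-n
  of \<open>y\<close>. This supplies preimages under the map from bit sequences to points with
  coordinates in [0, 1).\<close>

lemma binary_expansion:
  fixes y :: real
  assumes "0 \<le> y" "y < 1"
  obtains b :: "nat \<Rightarrow> real" where "\<And>i. b i \<in> {0, 1}" "(\<lambda>i. b i / 2 ^ Suc i) sums y"
proof -
  define b where "b i = real_of_int (\<lfloor>2 ^ Suc i * y\<rfloor> mod 2)" for i :: nat
  have partial: "(\<Sum>i<n. b i / 2 ^ Suc i) = real_of_int \<lfloor>2 ^ n * y\<rfloor> / 2 ^ n" for n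
  proof (induction n)
    case 0
    then show ?case using assms by (simp add: floor_eq_iff)
  next
    case (Suc n)
    have "\<lfloor>2 ^ Suc n * y\<rfloor> div 2 = \<lfloor>2 ^ Suc n * y / 2\<rfloor>"
      using floor_divide_real_eq_div[of 2 "2 ^ Suc n * y"] by simp
    then have "\<lfloor>2 ^ Suc n * y\<rfloor> = 2 * \<lfloor>2 ^ n * y\<rfloor> + \<lfloor>2 ^ Suc n * y\<rfloor> mod 2"
      by (metis mult_div_mod_eq nonzero_mult_div_cancel_left power_Suc times_divide_eq_left
          zero_neq_numeral)
    then have "real_of_int \<lfloor>2 ^ Suc n * y\<rfloor> = 2 * real_of_int \<lfloor>2 ^ n * y\<rfloor> + b n"
      unfolding b_def by (metis of_int_add of_int_mult of_int_numeral)
    with Suc show ?case by (simp add: field_simps)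
  qed
  have "(\<lambda>n. real_of_int \<lfloor>2 ^ n * y\<rfloor> / 2 ^ n) \<longlonglongrightarrow> y"
  proof (rule tendsto_sandwich)
    show "\<forall>\<^sub>F n in sequentially. y - 1 / 2 ^ n \<le> real_of_int \<lfloor>2 ^ n * y\<rfloor> / 2 ^ n"
    proof (rule always_eventually, rule allI)
      fix n :: nat
      have "(2 ^ n * y - 1) / 2 ^ n \<le> real_of_int \<lfloor>2 ^ n * y\<rfloor> / 2 ^ n"
        by (intro divide_right_mono) (linarith, simp)
      then show "y - 1 / 2 ^ n \<le> real_of_int \<lfloor>2 ^ n * y\<rfloor> / 2 ^ n"
        by (simp add: diff_divide_distrib)
    qed
    show "\<forall>\<^sub>F n in sequentially. real_of_int \<lfloor>2 ^ n * y\<rfloor> / 2 ^ n \<le> y"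
    proof (rule always_eventually, rule allI)
      fix n :: nat
      have "real_of_int \<lfloor>2 ^ n * y\<rfloor> \<le> 2 ^ n * y" by linarith
      then show "real_of_int \<lfloor>2 ^ n * y\<rfloor> / 2 ^ n \<le> y" by (simp add: field_simps)
    qed
    have "(\<lambda>n. y - (1 / 2) ^ n) \<longlonglongrightarrow> y - 0"
      by (intro tendsto_intros LIMSEQ_power_zero) simp
    then show "(\<lambda>n. y - 1 / 2 ^ n) \<longlonglongrightarrow> y" by (simp add: power_one_over)
  qed simp
  then have "(\<lambda>i. b i / 2 ^ Suc i) sums y" unfolding sums_def partial .
  moreover have "b i \<in> {0, 1}" for i
    unfolding b_def by (metis insertCI mod2_eq_if of_int_0 of_int_1)
  ultimately show ?thesis using that by blast
qed

text \<open>Base 4 in place of base 2 leaves gaps after the digits 0 and 1, so that distinct 0-1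
  sequences get distinct values; these values form a Cantor set on the line.\<close>

definition cantor_code :: "(nat \<Rightarrow> real) \<Rightarrow> real" where
  "cantor_code b = (\<Sum>k. b k / 4 ^ Suc k)"

lemma summable_cantor_code:
  assumes "\<And>k. b k \<in> {0, 1 :: real}"
  shows "summable (\<lambda>k. b k / 4 ^ Suc k)"
proof (rule summable_comparison_test')
  show "summable (\<lambda>k. (1 / 4 :: real) ^ k)" by (rule summable_geometric) simp
  show "norm (b k / 4 ^ Suc k) \<le> (1 / 4) ^ k" for k
    using assms[of k] by (auto simp: power_one_over field_simps)
qed

lemma cantor_code_bounds:
  assumes "\<And>k. b k \<in> {0, 1 :: real}"
  shows "0 \<le> cantor_code b" "cantor_code b \<le> 1 / 3"
proof -
  have nonneg: "0 \<le> b k" and le: "b k \<le> 1" for k using assms[of k] by auto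
  show "0 \<le> cantor_code b" unfolding cantor_code_def
    by (rule suminf_nonneg[OF summable_cantor_code[OF assms]]) (simp add: nonneg)
  have "(\<lambda>k. (1 / 4) * (1 / 4 :: real) ^ k) sums ((1 / 4) * (1 / (1 - 1 / 4)))"
    by (intro sums_mult geometric_sums) simp
  then have *: "(\<lambda>k. 1 / 4 ^ Suc k :: real) sums (1 / 3)" by (simp add: power_one_over)
  have "cantor_code b \<le> (\<Sum>k. 1 / 4 ^ Suc k)" unfolding cantor_code_def
    by (rule suminf_le[OF _ summable_cantor_code[OF assms] sums_summable[OF *]])
      (simp add: divide_right_mono le)
  then show "cantor_code b \<le> 1 / 3" using * by (simp add: sums_iff)
qed

lemma cantor_code_Suc:
  assumes "\<And>k. b k \<in> {0, 1 :: real}"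
  shows "cantor_code b = (b 0 + cantor_code (\<lambda>k. b (Suc k))) / 4"
proof -
  have s: "summable (\<lambda>k. b (Suc k) / 4 ^ Suc k)" by (rule summable_cantor_code) (rule assms)
  have "cantor_code b = (\<Sum>k. b (Suc k) / 4 ^ Suc (Suc k)) + b 0 / 4"
    using suminf_split_head[OF summable_cantor_code[of b, OF assms]] by (simp add: cantor_code_def)
  moreover have "(\<Sum>k. b (Suc k) / 4 ^ Suc (Suc k)) = (\<Sum>k. b (Suc k) / 4 ^ Suc k) / 4"
    using suminf_divide[OF s, of 4] by (simp add: field_simps)
  ultimately show ?thesis by (simp add: cantor_code_def add_divide_distrib)
qed

text \<open>Four times a code is the first digit plus the code of the tail. Codes of tails lie in
  [0, 1/3], so they cannot make up for a difference of 1 between first digits; induction then passes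
  to the tails.\<close>

lemma cantor_code_inject:
  assumes "\<And>k. b k \<in> {0, 1 :: real}" "\<And>k. c k \<in> {0, 1 :: real}"
    and "cantor_code b = cantor_code c"
  shows "b k = c k"
  using assms
proof (induction k arbitrary: b c)
  case 0
  have "0 \<le> cantor_code (\<lambda>k. b (Suc k))" "cantor_code (\<lambda>k. b (Suc k)) \<le> 1 / 3"
    "0 \<le> cantor_code (\<lambda>k. c (Suc k))" "cantor_code (\<lambda>k. c (Suc k)) \<le> 1 / 3"
    by (intro cantor_code_bounds 0)+
  moreover have "b 0 + cantor_code (\<lambda>k. b (Suc k)) = c 0 + cantor_code (\<lambda>k. c (Suc k))"
    using 0(3) cantor_code_Suc[of b, OF 0(1)] cantor_code_Suc[of c, OF 0(2)] by simp
  ultimately show ?case using 0(1)[of 0] 0(2)[of 0] by auto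
next
  case (Suc k)
  have "0 \<le> cantor_code (\<lambda>k. b (Suc k))" "cantor_code (\<lambda>k. b (Suc k)) \<le> 1 / 3"
    "0 \<le> cantor_code (\<lambda>k. c (Suc k))" "cantor_code (\<lambda>k. c (Suc k)) \<le> 1 / 3"
    by (intro cantor_code_bounds Suc.prems)+
  moreover have *: "b 0 + cantor_code (\<lambda>k. b (Suc k)) = c 0 + cantor_code (\<lambda>k. c (Suc k))"
    using Suc.prems(3) cantor_code_Suc[of b, OF Suc.prems(1)] cantor_code_Suc[of c, OF Suc.prems(2)]
    by simp
  ultimately have "b 0 = c 0" using Suc.prems(1)[of 0] Suc.prems(2)[of 0] by auto
  with * have "cantor_code (\<lambda>k. b (Suc k)) = cantor_code (\<lambda>k. c (Suc k))" by simp
  then show ?case using Suc.IH[of "\<lambda>k. b (Suc k)" "\<lambda>k. c (Suc k)"] Suc.prems by blast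
qed

section \<open>Continuous surjections from compact sets of reals\<close>

lemma compact_Pi:
  fixes B :: "'i \<Rightarrow> 'b::topological_space set"
  assumes "\<And>i. compact (B i)"
  shows "compact (Pi UNIV B)"
proof -
  have "compactin (product_topology (\<lambda>_. euclidean) UNIV) (PiE UNIV B)"
    unfolding compactin_PiE using assms by simp
  then show ?thesis by (simp add: euclidean_product_topology PiE_UNIV_domain)
qed

text \<open>Weierstrass M-test with majorants \<open>c k\<close>. The reindexing
  \<open>\<sigma>\<close> lets one statement serve both \<open>cantor_code\<close> and the sum over
  one row of a doubly indexed bit sequence.\<close>

lemma continuous_on_suminf_product:
  fixes c :: "nat \<Rightarrow> real" and \<sigma> :: "nat \<Rightarrow> nat"
  assumes "summable c" "\<And>k. 0 \<le> c k"
  shows "continuous_on (Pi UNIV (\<lambda>_. {0, 1})) (\<lambda>b. \<Sum>k. b (\<sigma> k) * c k)"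
proof (rule uniform_limit_theorem)
  show "uniform_limit (Pi UNIV (\<lambda>_. {0, 1})) (\<lambda>n b. \<Sum>k<n. b (\<sigma> k) * c k)
      (\<lambda>b. \<Sum>k. b (\<sigma> k) * c k) sequentially"
  proof (rule Weierstrass_m_test[OF _ assms(1)])
    fix n and b :: "nat \<Rightarrow> real"
    assume "b \<in> Pi UNIV (\<lambda>_. {0, 1})"
    then have "b (\<sigma> n) \<in> {0, 1}" by auto
    then show "norm (b (\<sigma> n) * c n) \<le> c n" using assms(2)[of n] by auto
  qed
  show "\<forall>\<^sub>F n in sequentially. continuous_on (Pi UNIV (\<lambda>_. {0, 1})) (\<lambda>b. \<Sum>k<n. b (\<sigma> k) * c k)"
    by (intro always_eventually allI continuous_intros
        continuous_on_subset[OF continuous_on_product_coordinates]) auto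
qed simp

text \<open>\<open>K\<close> embeds in a cube through its coordinates, bit sequences reach every
  point of that image by binary expansion, and bit sequences embed in the line by
  \<open>cantor_code\<close>. Restricting to the sequences that land in the image of
  \<open>K\<close> and composing with the two inverses, continuous by compactness, gives
  \<open>g\<close>.\<close>

theorem compact_metrizable_image_of_real_compact:
  fixes K :: "'b::topological_space set" and e :: "nat \<Rightarrow> 'b \<Rightarrow> real"
  assumes K: "compact K"
    and cont: "\<And>j. continuous_on K (e j)"
    and bnd: "\<And>j x. x \<in> K \<Longrightarrow> \<bar>e j x\<bar> \<le> 1"
    and sep: "\<And>x y. x \<in> K \<Longrightarrow> y \<in> K \<Longrightarrow> (\<And>j. e j x = e j y) \<Longrightarrow> x = y"
  obtains C :: "real set" and g where "compact C" "continuous_on C g" "g ` C = K"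
proof -
  define B :: "(nat \<Rightarrow> real) set" where "B = Pi UNIV (\<lambda>_. {0, 1})"
  have compB: "compact B" unfolding B_def by (rule compact_Pi) simp
  have BD: "b k \<in> {0, 1}" if "b \<in> B" for b k using that unfolding B_def by blast
  \<comment> \<open>Values lie in [1/4, 3/4], inside the half-open interval on which
    \<open>binary_expansion\<close> applies.\<close>
  define E where "E x = (\<lambda>j. (e j x + 2) / 4)" for x
  \<comment> \<open>\<open>prod_encode\<close> cuts one bit sequence into countably many rows; row
    \<open>j\<close> is read as the binary expansion of coordinate \<open>j\<close>.\<close>
  define Y where "Y b = (\<lambda>j. \<Sum>k. b (prod_encode (j, k)) * (1 / 2 ^ Suc k))"
    for b :: "nat \<Rightarrow> real"
  have contE: "continuous_on K E" unfolding E_def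
    by (intro continuous_on_coordinatewise_then_product continuous_intros cont) simp
  have s2: "summable (\<lambda>k. 1 / 2 ^ Suc k :: real)"
    using power_half_series by (simp add: sums_iff power_one_over)
  have contY: "continuous_on B Y" unfolding Y_def B_def
    by (intro continuous_on_coordinatewise_then_product continuous_on_suminf_product[OF s2]) simp
  have contT: "continuous_on B cantor_code"
  proof -
    have "summable (\<lambda>k. 1 / 4 ^ Suc k :: real)" using summable_cantor_code[of "\<lambda>_. 1"] by simp
    from continuous_on_suminf_product[OF this, of "\<lambda>k. k"] show ?thesis
      unfolding B_def cantor_code_def by simp
  qed
  define T' where "T' = inv_into B cantor_code"
  define E' where "E' = inv_into K E"
  have injT: "inj_on cantor_code B"
    by (intro inj_onI ext) (rule cantor_code_inject, auto dest: BD)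
  have injE: "inj_on E K"
    by (intro inj_onI sep) (auto simp: E_def fun_eq_iff)
  have contT': "continuous_on (cantor_code ` B) T'" unfolding T'_def
    by (rule continuous_on_inv[OF contT compB]) (simp add: inv_into_f_f[OF injT])
  have contE': "continuous_on (E ` K) E'" unfolding E'_def
    by (rule continuous_on_inv[OF contE K]) (simp add: inv_into_f_f[OF injE])
  define B' where "B' = B \<inter> Y -` (E ` K)"
  have surjY: "E ` K \<subseteq> Y ` B"
  proof
    fix z assume "z \<in> E ` K"
    then obtain x where x: "x \<in> K" "z = E x" by blast
    have "\<exists>b. (\<forall>i. b i \<in> {0, 1}) \<and> (\<lambda>i. b i / 2 ^ Suc i) sums z j" for j
    proof -
      have "0 \<le> z j" "z j < 1" using bnd[OF x(1), of j] by (auto simp: x(2) E_def)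
      then show ?thesis using binary_expansion by metis
    qed
    then obtain b :: "nat \<Rightarrow> nat \<Rightarrow> real"
      where b: "\<And>j i. b j i \<in> {0, 1}" "\<And>j. (\<lambda>i. b j i / 2 ^ Suc i) sums z j"
      by metis
    define c where "c n = (case prod_decode n of (j, i) \<Rightarrow> b j i)" for n
    have "c \<in> B" unfolding B_def c_def using b(1) by (auto split: prod.split)
    moreover have "Y c = z"
    proof
      fix j show "Y c j = z j" using b(2)[of j] by (simp add: Y_def c_def sums_iff)
    qed
    ultimately show "z \<in> Y ` B" by blast
  qed
  have compB': "compact B'"
  proof -
    have "closed (E ` K)" using contE K compact_continuous_image compact_imp_closed by blast
    then have "closedin (top_of_set B) B'" unfolding B'_def
      using continuous_closedin_preimage[OF contY] by blast
    then show ?thesis using closedin_compact[OF compB] by blast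
  qed
  define C where "C = cantor_code ` B'"
  define g where "g x = E' (Y (T' x))" for x
  have B'B: "B' \<subseteq> B" by (auto simp: B'_def)
  have T'C: "T' ` C = B'"
    unfolding C_def T'_def image_image using B'B by (force simp: inv_into_f_f[OF injT])
  have "Y ` (B \<inter> Y -` W) = Y ` B \<inter> W" for W by auto
  with surjY have YB': "Y ` B' = E ` K" unfolding B'_def by (simp add: Int_absorb1)
  show ?thesis
  proof
    show "compact C" unfolding C_def
      by (rule compact_continuous_image[OF continuous_on_subset[OF contT B'B] compB'])
    have "continuous_on C T'"
      using B'B by (intro continuous_on_subset[OF contT']) (auto simp: C_def)
    then have "continuous_on C (\<lambda>x. Y (T' x))"
      using T'C by (intro continuous_on_compose2[OF continuous_on_subset[OF contY B'B]]) auto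
    moreover have "(\<lambda>x. Y (T' x)) ` C \<subseteq> E ` K"
      using T'C YB' by (metis image_image order_refl)
    ultimately show "continuous_on C g"
      unfolding g_def by (rule continuous_on_compose2[OF contE'])
    show "g ` C = K"
    proof -
      have "g ` C = E' ` Y ` T' ` C" by (simp add: g_def image_image)
      also have "\<dots> = E' ` E ` K" by (simp add: T'C YB')
      also have "\<dots> = K" by (simp add: E'_def image_image inv_into_f_f[OF injE])
      finally show ?thesis .
    qed
  qed
qed

section \<open>Weak limits of discrete measures\<close>

text \<open>Supports in a common bounded interval give tightness, hence a weakly convergent
  subsequence by Helly's theorem. That the limit still lives on \<open>C\<close> is seen by testing
  against a truncated distance to \<open>C\<close>.\<close>

lemma real_pmf_convergent_subseq:
  fixes q :: "nat \<Rightarrow> real pmf"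
  assumes C: "compact C" and q: "\<And>n. set_pmf (q n) \<subseteq> C"
  obtains r :: "nat \<Rightarrow> nat" and M where "strict_mono r" "real_distribution M" "AE x in M. x \<in> C"
    "\<And>F :: real \<Rightarrow> real. continuous_on UNIV F \<Longrightarrow> bounded (range F) \<Longrightarrow>
       (\<lambda>n. \<integral>x. F x \<partial>measure_pmf (q (r n))) \<longlonglongrightarrow> (\<integral>x. F x \<partial>M)"
proof -
  define \<nu> where "\<nu> n = distr (measure_pmf (q n)) borel (\<lambda>x. x)" for n
  have rd: "real_distribution (\<nu> n)" for n
    unfolding \<nu>_def by (simp add: real_distribution_def real_distribution_axioms_def
        measure_pmf.prob_space_distr)
  obtain m where m: "\<And>x. x \<in> C \<Longrightarrow> \<bar>x\<bar> \<le> m"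
    using compact_imp_bounded[OF C] by (auto simp: bounded_iff)
  have "tight \<nu>"
    unfolding tight_def
  proof (intro conjI allI impI rd)
    fix \<epsilon> :: real assume "0 < \<epsilon>"
    \<comment> \<open>The margin 1 keeps \<open>C\<close> off the excluded left end point, and
      \<open>\<bar>m\<bar>\<close> makes the interval nondegenerate whatever the sign of
      \<open>m\<close>.\<close>
    have meas1: "measure (\<nu> n) {-\<bar>m\<bar> - 1<..\<bar>m\<bar> + 1} = 1" for n
    proof -
      have "x \<in> {-\<bar>m\<bar> - 1<..\<bar>m\<bar> + 1}" if "x \<in> set_pmf (q n)" for x
        using m[of x] q[of n] that by auto
      then have "AE x in measure_pmf (q n). x \<in> {-\<bar>m\<bar> - 1<..\<bar>m\<bar> + 1}"
        by (intro AE_pmfI)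
      then have "measure (measure_pmf (q n)) {-\<bar>m\<bar> - 1<..\<bar>m\<bar> + 1} = 1"
        by (subst measure_pmf.prob_eq_1) auto
      then show ?thesis by (simp add: \<nu>_def measure_distr)
    qed
    show "\<exists>a b. a < b \<and> (\<forall>n. 1 - \<epsilon> < measure (\<nu> n) {a<..b})"
      by (rule exI[of _ "-\<bar>m\<bar> - 1"], rule exI[of _ "\<bar>m\<bar> + 1"]) (auto simp: meas1 \<open>0 < \<epsilon>\<close>)
  qed
  from tight_imp_convergent_subsubsequence[OF this, of "\<lambda>n. n"]
  obtain r M where r: "strict_mono r" and M: "real_distribution M"
    and wc: "weak_conv_m (\<lambda>n. \<nu> (r n)) M"
    by (auto simp: comp_def strict_mono_def)
  interpret M: real_distribution M by (rule M)
  have conv: "(\<lambda>n. \<integral>x. F x \<partial>measure_pmf (q (r n))) \<longlonglongrightarrow> (\<integral>x. F x \<partial>M)"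
    if F: "continuous_on UNIV F" and bF: "bounded (range F)" for F :: "real \<Rightarrow> real"
  proof -
    obtain B where "\<And>x. norm (F x) \<le> B" using bF by (auto simp: bounded_iff)
    then have "(\<lambda>n. integral\<^sup>L (\<nu> (r n)) F) \<longlonglongrightarrow> integral\<^sup>L M F"
      using F by (intro weak_conv_imp_integral_bdd_continuous_conv[OF rd M wc])
        (auto simp: continuous_on_eq_continuous_at)
    moreover have "integral\<^sup>L (\<nu> n) F = (\<integral>x. F x \<partial>measure_pmf (q n))" for n
      unfolding \<nu>_def using F by (subst integral_distr) (auto intro: borel_measurable_continuous_onI)
    ultimately show ?thesis by simp
  qed
  have "C \<noteq> {}" using q[of 0] set_pmf_not_empty[of "q 0"] by blast
  \<comment> \<open>Truncation at 1 makes the distance a bounded test function; it still vanishes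
    exactly on the closed set \<open>C\<close>.\<close>
  define D where "D x = min 1 (infdist x C)" for x
  have contD: "continuous_on UNIV D" unfolding D_def by (intro continuous_intros)
  have D01: "0 \<le> D x" "D x \<le> 1" for x unfolding D_def by (auto simp: infdist_nonneg)
  have "(\<lambda>n. \<integral>x. D x \<partial>measure_pmf (q (r n))) \<longlonglongrightarrow> (\<integral>x. D x \<partial>M)"
    using D01 by (intro conv contD) (auto simp: bounded_iff abs_le_iff intro!: exI[of _ 1] order_trans[OF _ D01(1)])
  moreover have "(\<integral>x. D x \<partial>measure_pmf (q n)) = 0" for n
  proof -
    have "AE x in measure_pmf (q n). D x = 0"
      using q[of n] by (intro AE_pmfI) (auto simp: D_def)
    then show ?thesis by (subst integral_cong_AE[where g = "\<lambda>_. 0"]) auto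
  qed
  ultimately have "(\<integral>x. D x \<partial>M) = 0" by (simp add: LIMSEQ_const_iff)
  moreover have Dm: "D \<in> borel_measurable borel" by (rule borel_measurable_continuous_onI[OF contD])
  moreover have "integrable M D"
    by (rule M.integrable_const_bound[of _ 1]) (use D01 Dm in auto)
  ultimately have "AE x in M. D x = 0"
    using integral_nonneg_eq_0_iff_AE[of M D] D01 by auto
  then have "AE x in M. x \<in> C"
  proof eventually_elim
    case (elim x)
    then have "infdist x C = 0" by (simp add: D_def min_def split: if_splits)
    then show ?case
      using in_closed_iff_infdist_zero[OF compact_imp_closed[OF C] \<open>C \<noteq> {}\<close>] by simp
  qed
  from r M this conv show ?thesis by (rule that)
qed

text \<open>The measures are moved to the line by a section \<open>h\<close> of \<open>g\<close>,
  and the limit is moved back by \<open>g\<close>. An arbitrary section will do, because a pmf is a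
  measure on all subsets and \<open>h\<close> has no measurability to satisfy.\<close>

theorem pmf_convergent_subseq:
  fixes K :: "'b::topological_space set" and e :: "nat \<Rightarrow> 'b \<Rightarrow> real" and p :: "nat \<Rightarrow> 'b pmf"
  assumes K: "compact K"
    and cont: "\<And>j. continuous_on K (e j)"
    and bnd: "\<And>j x. x \<in> K \<Longrightarrow> \<bar>e j x\<bar> \<le> 1"
    and sep: "\<And>x y. x \<in> K \<Longrightarrow> y \<in> K \<Longrightarrow> (\<And>j. e j x = e j y) \<Longrightarrow> x = y"
    and p: "\<And>n. set_pmf (p n) \<subseteq> K"
  obtains r :: "nat \<Rightarrow> nat" and \<mu> where "strict_mono r" "prob_space \<mu>"
    "sets \<mu> = sets (restrict_space borel K)"
    "\<And>F :: 'b \<Rightarrow> real. continuous_on K F \<Longrightarrow>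
       (\<lambda>n. \<integral>x. F x \<partial>measure_pmf (p (r n))) \<longlonglongrightarrow> (\<integral>x. F x \<partial>\<mu>)"
proof -
  obtain C :: "real set" and g where C: "compact C" and g: "continuous_on C g" "g ` C = K"
    by (rule compact_metrizable_image_of_real_compact[OF K cont bnd sep])
  define h where "h = inv_into C g"
  have h: "h x \<in> C" "g (h x) = x" if "x \<in> K" for x
    using that unfolding h_def g(2)[symmetric] by (auto intro: inv_into_into f_inv_into_f)
  have C': "set_pmf (map_pmf h (p n)) \<subseteq> C" for n using p[of n] h by auto
  obtain r :: "nat \<Rightarrow> nat" and M where r: "strict_mono r" and M: "real_distribution M" "AE x in M. x \<in> C"
    and conv: "\<And>F :: real \<Rightarrow> real. continuous_on UNIV F \<Longrightarrow> bounded (range F) \<Longrightarrow>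
       (\<lambda>n. \<integral>x. F x \<partial>measure_pmf (map_pmf h (p (r n)))) \<longlonglongrightarrow> (\<integral>x. F x \<partial>M)"
    by (rule real_pmf_convergent_subseq[of C "\<lambda>n. map_pmf h (p n)", OF C C'])
      (rule that, assumption+)
  interpret M: real_distribution M by (rule M)
  obtain x0 where x0: "x0 \<in> K" using p[of 0] set_pmf_not_empty[of "p 0"] by blast
  \<comment> \<open>Off \<open>C\<close>, a null set of \<open>M\<close>, the value is an arbitrary
    point \<open>x0\<close>, so that \<open>G\<close> maps the whole line into
    \<open>K\<close>.\<close>
  define G where "G x = (if x \<in> C then g x else x0)" for x
  have GK: "G x \<in> K" for x using x0 g(2) by (auto simp: G_def)
  have [measurable]: "C \<in> sets borel" using compact_imp_closed[OF C] by (rule borel_closed)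
  have "G \<in> borel_measurable borel" unfolding G_def
    by (subst measurable_If_restrict_space_iff)
      (auto intro: borel_measurable_continuous_on_restrict g compact_imp_closed[OF C])
  then have Gm: "G \<in> M \<rightarrow>\<^sub>M restrict_space borel K"
    by (auto intro!: measurable_restrict_space2 simp: GK)
  define \<mu> where "\<mu> = distr M (restrict_space borel K) G"
  show ?thesis
  proof
    show "strict_mono r" by fact
    show "prob_space \<mu>" unfolding \<mu>_def by (rule M.prob_space_distr[OF Gm])
    show "sets \<mu> = sets (restrict_space borel K)" by (simp add: \<mu>_def)
    fix F :: "'b \<Rightarrow> real" assume F: "continuous_on K F"
    have "bounded (F ` K)" using compact_continuous_image[OF F K] compact_imp_bounded by blast
    then obtain b where b: "\<And>x. x \<in> K \<Longrightarrow> norm (F x) \<le> b" by (auto simp: bounded_iff)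
    have "continuous_on C (\<lambda>x. F (g x))"
      using continuous_on_compose2[OF F g(1)] g(2) by blast
    moreover have "norm (F (g x)) \<le> max 0 b" if "x \<in> C" for x
      using b[of "g x"] g(2) that by (auto intro: le_max_iff_disj[THEN iffD2])
    \<comment> \<open>Weak convergence on the line tests functions on all of the reals, so the
      pullback of \<open>F\<close> is extended from \<open>C\<close> with the same bound, kept
      nonnegative by the maximum with 0.\<close>
    ultimately obtain F' where F': "continuous_on UNIV F'" "\<And>x. x \<in> C \<Longrightarrow> F' x = F (g x)"
      "\<And>x. norm (F' x) \<le> max 0 b"
      using Tietze[of C "\<lambda>x. F (g x)" UNIV "max 0 b"] compact_imp_closed[OF C] by auto
    have "bounded (range F')" using F'(3) by (auto simp: bounded_iff)
    from conv[OF F'(1) this]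
    have "(\<lambda>n. \<integral>x. F' (h x) \<partial>measure_pmf (p (r n))) \<longlonglongrightarrow> (\<integral>x. F' x \<partial>M)" by simp
    moreover have "(\<integral>x. F' (h x) \<partial>measure_pmf (p n)) = (\<integral>x. F x \<partial>measure_pmf (p n))" for n
      using p[of n] by (intro integral_cong_AE AE_pmfI) (auto simp: F'(2) h)
    moreover have Fm: "F \<in> borel_measurable (restrict_space borel K)"
      by (rule borel_measurable_continuous_on_restrict[OF F])
    moreover have "(\<integral>x. F' x \<partial>M) = (\<integral>x. F x \<partial>\<mu>)"
    proof -
      have "(\<integral>x. F' x \<partial>M) = (\<integral>x. F (G x) \<partial>M)"
      proof (rule integral_cong_AE)
        show "AE x in M. F' x = F (G x)" using M(2) by eventually_elim (simp add: F'(2) G_def)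
        show "(\<lambda>x. F (G x)) \<in> borel_measurable M" by (rule measurable_compose[OF Gm Fm])
        show "F' \<in> borel_measurable M"
          using borel_measurable_continuous_onI[OF F'(1)] by simp
      qed
      then show ?thesis unfolding \<mu>_def by (simp add: integral_distr[OF Gm Fm])
    qed
    ultimately show "(\<lambda>n. \<integral>x. F x \<partial>measure_pmf (p (r n))) \<longlonglongrightarrow> (\<integral>x. F x \<partial>\<mu>)" by simp
  qed
qed

section \<open>Choquet's theorem\<close>

lemma integrable_pmf_bounded:
  fixes F :: "'b \<Rightarrow> real"
  assumes "set_pmf p \<subseteq> K" "\<And>x. x \<in> K \<Longrightarrow> \<bar>F x\<bar> \<le> B"
  shows "integrable (measure_pmf p) F"
  using assms by (intro measure_pmf.integrable_const_bound[of _ B] AE_pmfI) auto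

text \<open>The convex combination (1 - t) p + t \<delta>_y: the variation of \<open>p\<close>
  towards a point mass, from which the first order condition is read off.\<close>

definition mix_pmf :: "real \<Rightarrow> 'b \<Rightarrow> 'b pmf \<Rightarrow> 'b pmf" where
  "mix_pmf t y p = bind_pmf (bernoulli_pmf t) (\<lambda>b. if b then return_pmf y else p)"

lemma set_mix_pmf: "set_pmf (mix_pmf t y p) \<subseteq> insert y (set_pmf p)"
  by (auto simp: mix_pmf_def split: if_splits)

lemma expectation_mix_pmf:
  fixes F :: "'b \<Rightarrow> real"
  assumes "set_pmf p \<subseteq> K" "y \<in> K" "\<And>x. x \<in> K \<Longrightarrow> \<bar>F x\<bar> \<le> B" "0 \<le> t" "t \<le> 1"
  shows "measure_pmf.expectation (mix_pmf t y p) F = (1 - t) * measure_pmf.expectation p F + t * F y"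
proof -
  \<comment> \<open>\<open>F\<close> is bounded only on \<open>K\<close>, while integration against
    \<open>bind_pmf\<close> wants a global bound; cutting off outside \<open>K\<close> changes no
    expectation.\<close>
  define G where "G x = (if x \<in> K then F x else 0)" for x
  have "0 \<le> B" using assms(2,3) by fastforce
  then have Gb: "\<bar>G x\<bar> \<le> B" for x using assms(3) by (auto simp: G_def)
  have FG: "measure_pmf.expectation q F = measure_pmf.expectation q G" if "set_pmf q \<subseteq> K" for q
    using that by (intro integral_cong_AE AE_pmfI) (auto simp: G_def)
  have "measure_pmf.expectation (mix_pmf t y p) G =
      (\<integral>b. measure_pmf.expectation (if b then return_pmf y else p) G \<partial>bernoulli_pmf t)"
    unfolding mix_pmf_def measure_pmf_bind
    by (rule integral_bind[where K = "count_space UNIV" and B = B and B' = 1])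
      (auto simp: Gb measure_pmf.finite_measure_axioms space_subprob_algebra
        subprob_space_measure_pmf measure_pmf.emeasure_space_1[simplified])
  also have "\<dots> = (1 - t) * measure_pmf.expectation p G + t * G y"
    using assms(4,5) by simp
  finally show ?thesis
    using FG[of p] FG[of "mix_pmf t y p"] set_mix_pmf[of t y p] assms(1,2) by (auto simp: G_def)
qed

text \<open>A near minimiser \<open>p\<close> of the penalised functional \<open>J\<close> is
  compared with two kinds of competitors. The point mass at \<phi> bounds the penalty;
  \<open>mix_pmf t x p\<close> yields the affine majorant at \<open>x\<close>.\<close>

lemma approximate_affine_majorant:
  fixes e :: "nat \<Rightarrow> 'b \<Rightarrow> real" and f :: "'b \<Rightarrow> real" and N :: nat
  assumes e: "\<And>k x. x \<in> K \<Longrightarrow> \<bar>e k x\<bar> \<le> 1"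
    and f: "\<And>x. x \<in> K \<Longrightarrow> 0 \<le> f x" "\<And>x. x \<in> K \<Longrightarrow> f x \<le> 2"
    and \<phi>: "\<phi> \<in> K"
  obtains p :: "'b pmf" and a :: real and c :: "nat \<Rightarrow> real" where "set_pmf p \<subseteq> K"
    "real N * (\<Sum>k<N. (measure_pmf.expectation p (e k) - e k \<phi>)\<^sup>2) \<le> 3"
    "\<And>x. x \<in> K \<Longrightarrow> f x \<le> a + (\<Sum>k<N. c k * e k x) + 5 / real (Suc N)"
    "a + (\<Sum>k<N. c k * e k \<phi>) \<le> measure_pmf.expectation p f"
proof -
  define E where "E p F = measure_pmf.expectation p F" for p and F :: "'b \<Rightarrow> real"
  define J where "J p = real N * (\<Sum>k<N. (E p (e k) - e k \<phi>)\<^sup>2) - E p f" for p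
  define P where "P = {p. set_pmf p \<subseteq> K}"
  have fabs: "\<bar>f x\<bar> \<le> 2" if "x \<in> K" for x using f[OF that] by simp
  have Ef: "E p f \<le> 2" if "p \<in> P" for p
    unfolding E_def using that f(2) fabs
    by (intro measure_pmf.integral_le_const[OF integrable_pmf_bounded[of _ K _ 2]] AE_pmfI)
      (auto simp: P_def)
  have Ee: "\<bar>E p (e k)\<bar> \<le> 1" if "p \<in> P" for p k
  proof -
    have i: "integrable (measure_pmf p) (e k)"
      using that e by (intro integrable_pmf_bounded[of _ K _ 1]) (auto simp: P_def)
    have "AE x in measure_pmf p. e k x \<le> 1 \<and> -1 \<le> e k x"
      using that e by (intro AE_pmfI) (force simp: P_def abs_le_iff)
    then have "E p (e k) \<le> 1" "-1 \<le> E p (e k)" unfolding E_def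
      by (auto intro!: measure_pmf.integral_le_const[OF i] measure_pmf.integral_ge_const[OF i])
    then show ?thesis by simp
  qed
  have "-2 \<le> J p" if "p \<in> P" for p
  proof -
    have "0 \<le> real N * (\<Sum>k<N. (E p (e k) - e k \<phi>)\<^sup>2)" by (simp add: sum_nonneg)
    then show ?thesis using Ef[OF that] by (simp add: J_def)
  qed
  then have bdd: "bdd_below (J ` P)" by (intro bdd_belowI[of _ "-2"]) auto
  have ret: "return_pmf \<phi> \<in> P" using \<phi> by (simp add: P_def)
  \<comment> \<open>Step size for the variation. Dividing the optimality inequality by
    \<open>t\<close> leaves an error t (N \<Sum> d_k^2 + 1) with d_k^2 \<le> 4, at most 5 t (N +
    1)^2; the cube turns this into 5 / (N + 1). The slack t^2 in near minimality is of second order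
    for the same reason.\<close>
  define t where "t = 1 / real (Suc N) ^ 3"
  have t: "0 < t" "t \<le> 1" unfolding t_def by (auto simp: divide_simps intro: one_le_power)
  have "\<exists>p\<in>P. J p < (INF q\<in>P. J q) + t\<^sup>2"
    using cInf_lessD[of "J ` P" "(INF q\<in>P. J q) + t\<^sup>2"] ret t by auto
  then obtain p where p: "p \<in> P" "J p < (INF q\<in>P. J q) + t\<^sup>2" by blast
  have opt: "J p \<le> J q + t\<^sup>2" if "q \<in> P" for q
    using p(2) cINF_lower[OF bdd that] by simp
  have Kp: "set_pmf p \<subseteq> K" using p(1) by (simp add: P_def)
  define m where "m k = E p (e k)" for k
  \<comment> \<open>\<open>c k\<close> is the partial derivative of the penalty at the means
    \<open>m\<close>, and \<open>a\<close> is fixed so that the affine function has value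
    \<open>E p f\<close> at these means.\<close>
  define c where "c k = 2 * real N * (m k - e k \<phi>)" for k
  define a where "a = E p f - (\<Sum>k<N. c k * m k)"
  have h: "a + (\<Sum>k<N. c k * e k x) = E p f + (\<Sum>k<N. c k * (e k x - m k))" for x
    by (simp add: a_def sum_subtractf right_diff_distrib)
  show ?thesis
  proof
    show "set_pmf p \<subseteq> K" by (rule Kp)
    \<comment> \<open>The penalty vanishes at this competitor, so that of \<open>p\<close> is at
      most E p f - f(\<phi>) + t^2 \<le> 2 + 0 + 1.\<close>
    have "J p \<le> J (return_pmf \<phi>) + t\<^sup>2" by (rule opt[OF ret])
    moreover have "J (return_pmf \<phi>) = - f \<phi>" by (simp add: J_def E_def)
    moreover have "t\<^sup>2 \<le> 1" using t by (simp add: power_le_one)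
    ultimately show "real N * (\<Sum>k<N. (measure_pmf.expectation p (e k) - e k \<phi>)\<^sup>2) \<le> 3"
      using f(1)[OF \<phi>] Ef[OF p(1)] by (simp add: J_def E_def)
    show "a + (\<Sum>k<N. c k * e k \<phi>) \<le> measure_pmf.expectation p f"
    proof -
      \<comment> \<open>Going from the means to the coordinates of \<phi> runs against the gradient
        of the penalty, so the affine function cannot increase.\<close>
      have "c k * (e k \<phi> - m k) = - (2 * real N * (m k - e k \<phi>)\<^sup>2)" for k
        by (simp add: c_def power2_eq_square algebra_simps)
      then have "(\<Sum>k<N. c k * (e k \<phi> - m k)) \<le> 0" by (intro sum_nonpos) simp
      then show ?thesis unfolding h by (simp add: E_def)
    qed
    fix x assume x: "x \<in> K"
    define d where "d k = e k x - m k" for k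
    let ?q = "mix_pmf t x p"
    have q: "?q \<in> P" using set_mix_pmf[of t x p] x Kp by (auto simp: P_def)
    have Eq: "E ?q (e k) = m k + t * d k" for k
      unfolding E_def using t
      by (subst expectation_mix_pmf[OF Kp x e]) (auto simp: m_def d_def E_def algebra_simps)
    have Eqf: "E ?q f = E p f + t * (f x - E p f)"
      unfolding E_def using t
      by (subst expectation_mix_pmf[OF Kp x fabs]) (auto simp: algebra_simps)
    have d2: "(d k)\<^sup>2 \<le> 4" for k
    proof -
      have "\<bar>d k\<bar> \<le> 2" using e[OF x, of k] Ee[OF p(1), of k] by (simp add: d_def m_def)
      then show ?thesis using power_mono[of "\<bar>d k\<bar>" 2 2] by simp
    qed
    have sq: "real N * (m k + t * d k - e k \<phi>)\<^sup>2 =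
        real N * (m k - e k \<phi>)\<^sup>2 + t * (c k * d k) + t\<^sup>2 * (real N * (d k)\<^sup>2)" for k
      by (simp add: c_def power2_eq_square algebra_simps)
    have "real N * (\<Sum>k<N. (m k + t * d k - e k \<phi>)\<^sup>2) =
        real N * (\<Sum>k<N. (m k - e k \<phi>)\<^sup>2) + t * (\<Sum>k<N. c k * d k)
          + t\<^sup>2 * (real N * (\<Sum>k<N. (d k)\<^sup>2))"
      by (simp only: sum_distrib_left sq sum.distrib)
    then have "J ?q = J p + t * (\<Sum>k<N. c k * d k) + t\<^sup>2 * (real N * (\<Sum>k<N. (d k)\<^sup>2))
        - t * (f x - E p f)"
      unfolding J_def Eq Eqf by (simp add: m_def)
    with opt[OF q] have "0 \<le> t * (\<Sum>k<N. c k * d k) + t\<^sup>2 * (real N * (\<Sum>k<N. (d k)\<^sup>2))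
        - t * (f x - E p f) + t\<^sup>2"
      by simp
    also have "\<dots> = t * ((\<Sum>k<N. c k * d k) + E p f - f x + t * (real N * (\<Sum>k<N. (d k)\<^sup>2) + 1))"
      by (simp add: power2_eq_square algebra_simps)
    finally have "f x \<le> E p f + (\<Sum>k<N. c k * d k) + t * (real N * (\<Sum>k<N. (d k)\<^sup>2) + 1)"
      using t by (simp add: zero_le_mult_iff)
    moreover have "t * (real N * (\<Sum>k<N. (d k)\<^sup>2) + 1) \<le> 5 / real (Suc N)"
    proof -
      have "(\<Sum>k<N. (d k)\<^sup>2) \<le> real N * 4" using sum_bounded_above[of "{..<N}" "\<lambda>k. (d k)\<^sup>2" 4] d2 by simp
      then have "real N * (\<Sum>k<N. (d k)\<^sup>2) + 1 \<le> real N * (real N * 4) + 1"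
        by (intro add_mono mult_left_mono) auto
      also have "\<dots> \<le> 5 * real (Suc N) ^ 2" by (simp add: power2_eq_square algebra_simps)
      finally have "t * (real N * (\<Sum>k<N. (d k)\<^sup>2) + 1) \<le> t * (5 * real (Suc N) ^ 2)"
        using t by (intro mult_left_mono) auto
      also have "\<dots> = 5 / real (Suc N)" by (simp add: t_def power2_eq_square power3_eq_cube)
      finally show ?thesis .
    qed
    ultimately show "f x \<le> a + (\<Sum>k<N. c k * e k x) + 5 / real (Suc N)"
      unfolding h d_def by simp
  qed
qed

text \<open>\<open>K\<close> carries no linear structure here: the coordinates \<open>e j\<close>
  play the role of affine functions, and both the barycenter and extremality are expressed through
  them.\<close>

theorem Choquet_metrizable:
  fixes K :: "'b::topological_space set" and e :: "nat \<Rightarrow> 'b \<Rightarrow> real"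
  assumes K: "compact K"
    and cont: "\<And>j. continuous_on K (e j)"
    and bnd: "\<And>j x. x \<in> K \<Longrightarrow> \<bar>e j x\<bar> \<le> 1"
    and sep: "\<And>x y. x \<in> K \<Longrightarrow> y \<in> K \<Longrightarrow> (\<And>j. e j x = e j y) \<Longrightarrow> x = y"
    and \<phi>: "\<phi> \<in> K"
  obtains \<mu> where "prob_space \<mu>" "sets \<mu> = sets (restrict_space borel K)"
    "\<And>j. (\<integral>x. e j x \<partial>\<mu>) = e j \<phi>"
    "AE x in \<mu>. \<forall>y\<in>K. \<forall>z\<in>K. \<forall>t. 0 < t \<and> t < 1 \<and> (\<forall>j. e j x = (1 - t) * e j y + t * e j z) \<longrightarrow>
       y = x \<and> z = x"
proof -
  \<comment> \<open>Geometric weights give uniform convergence, hence continuity; strict convexity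
    comes from the coordinates separating points.\<close>
  define f where "f x = (\<Sum>k. (1 / 2) ^ k * (e k x)\<^sup>2)" for x
  have sg: "summable (\<lambda>k. (1 / 2 :: real) ^ k)" by (rule summable_geometric) simp
  have e2: "(e k x)\<^sup>2 \<le> 1" if "x \<in> K" for k x
    using bnd[OF that, of k] by (simp add: abs_square_le_1)
  have fsum: "summable (\<lambda>k. (1 / 2) ^ k * (e k x)\<^sup>2)" if "x \<in> K" for x
    using e2[OF that] by (intro summable_comparison_test'[OF sg]) (simp add: mult_left_le)
  have f0: "0 \<le> f x" if "x \<in> K" for x
    unfolding f_def by (rule suminf_nonneg[OF fsum[OF that]]) simp
  have f2: "f x \<le> 2" if "x \<in> K" for x
  proof -
    have "f x \<le> (\<Sum>k. (1 / 2) ^ k)" unfolding f_def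
      by (rule suminf_le[OF _ fsum[OF that] sg]) (simp add: mult_left_le e2[OF that])
    also have "\<dots> = 2" using suminf_geometric[of "1 / 2 :: real"] by simp
    finally show ?thesis .
  qed
  have contf: "continuous_on K f"
  proof (rule uniform_limit_theorem)
    show "uniform_limit K (\<lambda>n x. \<Sum>k<n. (1 / 2) ^ k * (e k x)\<^sup>2) f sequentially"
      unfolding f_def by (rule Weierstrass_m_test[OF _ sg]) (simp add: mult_left_le e2)
    show "\<forall>\<^sub>F n in sequentially. continuous_on K (\<lambda>x. \<Sum>k<n. (1 / 2) ^ k * (e k x)\<^sup>2)"
      by (intro always_eventually allI continuous_intros cont)
  qed simp
  define good where "good N p a c \<longleftrightarrow> set_pmf p \<subseteq> K \<and>
      real N * (\<Sum>k<N. (measure_pmf.expectation p (e k) - e k \<phi>)\<^sup>2) \<le> 3 \<and>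
      (\<forall>x\<in>K. f x \<le> a + (\<Sum>k<N. c k * e k x) + 5 / real (Suc N)) \<and>
      a + (\<Sum>k<N. c k * e k \<phi>) \<le> measure_pmf.expectation p f" for N p a c
  have "\<exists>p a c. good N p a c" for N
    unfolding good_def
    by (rule approximate_affine_majorant[of K e f \<phi> N], (rule bnd f0 f2 \<phi>; assumption)+, blast)
  then obtain p :: "nat \<Rightarrow> 'b pmf" and a c where good: "\<And>N. good N (p N) (a N) (c N)"
    by metis
  have p: "\<And>N. set_pmf (p N) \<subseteq> K"
    and near: "\<And>N. real N * (\<Sum>k<N. (measure_pmf.expectation (p N) (e k) - e k \<phi>)\<^sup>2) \<le> 3"
    and major: "\<And>N x. x \<in> K \<Longrightarrow> f x \<le> a N + (\<Sum>k<N. c N k * e k x) + 5 / real (Suc N)"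
    and below: "\<And>N. a N + (\<Sum>k<N. c N k * e k \<phi>) \<le> measure_pmf.expectation (p N) f"
    using good unfolding good_def by blast+
  obtain r :: "nat \<Rightarrow> nat" and \<mu> where r: "strict_mono r" and \<mu>: "prob_space \<mu>"
    "sets \<mu> = sets (restrict_space borel K)"
    and conv: "\<And>F :: 'b \<Rightarrow> real. continuous_on K F \<Longrightarrow>
       (\<lambda>n. \<integral>x. F x \<partial>measure_pmf (p (r n))) \<longlonglongrightarrow> (\<integral>x. F x \<partial>\<mu>)"
    by (rule pmf_convergent_subseq[of K e p]) ((rule K cont bnd sep p that; assumption)+)
  interpret \<mu>: prob_space \<mu> by (rule \<mu>)
  have space: "space \<mu> = K" using sets_eq_imp_space_eq[OF \<mu>(2)] by (simp add: space_restrict_space)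
  have int: "integrable \<mu> F" if F: "continuous_on K F" for F :: "'b \<Rightarrow> real"
  proof -
    obtain b where "\<And>x. x \<in> K \<Longrightarrow> norm (F x) \<le> b"
      using compact_imp_bounded[OF compact_continuous_image[OF F K]] by (auto simp: bounded_iff)
    moreover have "F \<in> borel_measurable \<mu>"
      using borel_measurable_continuous_on_restrict[OF F] by (simp cong: measurable_cong_sets add: \<mu>(2))
    ultimately show ?thesis
      by (intro \<mu>.integrable_const_bound[of _ b]) (auto simp: space)
  qed
  have bary: "(\<integral>x. e j x \<partial>\<mu>) = e j \<phi>" for j
  proof -
    let ?m = "\<lambda>n. measure_pmf.expectation (p n) (e j)"
    have "(\<lambda>n. (?m n - e j \<phi>)\<^sup>2) \<longlonglongrightarrow> 0"
    proof (rule tendsto_sandwich[of "\<lambda>_. 0"])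
      \<comment> \<open>Once n > j, coordinate \<open>j\<close> is among those penalised, and the
        penalty bound 3 is divided by its weight \<open>n\<close>.\<close>
      show "\<forall>\<^sub>F n in sequentially. (?m n - e j \<phi>)\<^sup>2 \<le> 3 / real n"
        using eventually_gt_at_top[of j]
      proof eventually_elim
        case (elim n)
        have "(?m n - e j \<phi>)\<^sup>2 \<le> (\<Sum>k<n. (measure_pmf.expectation (p n) (e k) - e k \<phi>)\<^sup>2)"
          using elim by (intro member_le_sum) auto
        then have "real n * (?m n - e j \<phi>)\<^sup>2 \<le> 3"
          using near[of n] by (meson mult_left_mono of_nat_0_le_iff order_trans)
        then show ?case using elim by (simp add: field_simps)
      qed
      show "(\<lambda>n. 3 / real n) \<longlonglongrightarrow> 0" by (rule lim_const_over_n)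
    qed auto
    then have "(\<lambda>n. (?m (r n) - e j \<phi>)\<^sup>2) \<longlonglongrightarrow> 0" using LIMSEQ_subseq_LIMSEQ[OF _ r] by (fastforce simp: comp_def)
    then have "(\<lambda>n. sqrt ((?m (r n) - e j \<phi>)\<^sup>2)) \<longlonglongrightarrow> sqrt 0" by (rule tendsto_real_sqrt)
    then have "(\<lambda>n. ?m (r n)) \<longlonglongrightarrow> e j \<phi>"
      by (simp add: tendsto_rabs_zero_iff LIM_zero_iff)
    then show ?thesis using LIMSEQ_unique conv[OF cont] by blast
  qed
  define h where "h n x = a (r n) + (\<Sum>k<r n. c (r n) k * e k x)" for n x
  \<comment> \<open>Gap between the affine majorant and \<open>f\<close>, shifted by the error term
    so as to be nonnegative on \<open>K\<close>.\<close>
  define g where "g n x = h n x - f x + 5 / real (Suc (r n))" for n x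
  have conth: "continuous_on K (h n)" for n
    unfolding h_def by (intro continuous_intros cont)
  then have contg: "continuous_on K (g n)" for n
    unfolding g_def by (intro continuous_intros contf)
  have g0: "0 \<le> g n x" if "x \<in> K" for n x
    using major[OF that, of "r n"] by (simp add: g_def h_def)
  have eps: "(\<lambda>n. 5 / real (Suc (r n))) \<longlonglongrightarrow> 0"
    using LIMSEQ_subseq_LIMSEQ[OF LIMSEQ_Suc[OF lim_const_over_n[of 5]] r] by (simp add: comp_def)
  have "(\<integral>x. h n x \<partial>\<mu>) = h n \<phi>" for n
    unfolding h_def using int[OF cont] bary by (simp add: \<mu>.prob_space)
  then have intg: "(\<integral>x. g n x \<partial>\<mu>) = h n \<phi> - (\<integral>x. f x \<partial>\<mu>) + 5 / real (Suc (r n))" for n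
    unfolding g_def using int[OF conth] int[OF contf] by (simp add: \<mu>.prob_space)
  \<comment> \<open>By the barycenter formula the integral of \<open>h n\<close> is h_n(\<phi>),
    which is at most the expectation of \<open>f\<close> under \<open>p (r n)\<close>; that tends to
    the integral of \<open>f\<close> under \<open>\<mu>\<close>. Convergence in L1 then gives
    convergence almost everywhere along a further subsequence.\<close>
  have "(\<lambda>n. \<integral>x. norm (g n x) \<partial>\<mu>) \<longlonglongrightarrow> 0"
  proof (rule tendsto_sandwich[of "\<lambda>_. 0"])
    have normg: "(\<integral>x. norm (g n x) \<partial>\<mu>) = (\<integral>x. g n x \<partial>\<mu>)" for n
      by (rule Bochner_Integration.integral_cong) (auto simp: space g0)
    show "\<forall>\<^sub>F n in sequentially. (\<integral>x. norm (g n x) \<partial>\<mu>) \<le>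
        (\<integral>x. f x \<partial>measure_pmf (p (r n))) - (\<integral>x. f x \<partial>\<mu>) + 5 / real (Suc (r n))"
      unfolding normg intg using below by (auto simp: h_def)
    have "(\<lambda>n. (\<integral>x. f x \<partial>measure_pmf (p (r n))) - (\<integral>x. f x \<partial>\<mu>) + 5 / real (Suc (r n)))
        \<longlonglongrightarrow> (\<integral>x. f x \<partial>\<mu>) - (\<integral>x. f x \<partial>\<mu>) + 0"
      by (intro tendsto_intros conv contf eps)
    then show "(\<lambda>n. (\<integral>x. f x \<partial>measure_pmf (p (r n))) - (\<integral>x. f x \<partial>\<mu>) + 5 / real (Suc (r n)))
        \<longlonglongrightarrow> 0"
      by simp
  qed auto
  from tendsto_L1_AE_subseq[OF int[OF contg] this]
  obtain s where s: "strict_mono s" "AE x in \<mu>. (\<lambda>n. g (s n) x) \<longlonglongrightarrow> 0" by blast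
  have "AE x in \<mu>. x \<in> K" using AE_space[of \<mu>] by (simp add: space)
  with s(2) have "AE x in \<mu>. \<forall>y\<in>K. \<forall>z\<in>K. \<forall>t.
      0 < t \<and> t < 1 \<and> (\<forall>j. e j x = (1 - t) * e j y + t * e j z) \<longrightarrow> y = x \<and> z = x"
  proof eventually_elim
    case (elim x)
    show ?case
    proof (intro ballI allI impI)
      fix y z and t :: real
      assume y: "y \<in> K" and z: "z \<in> K"
        and t: "0 < t \<and> t < 1 \<and> (\<forall>j. e j x = (1 - t) * e j y + t * e j z)"
      have ex: "e j x = (1 - t) * e j y + t * e j z" for j using t by blast
      \<comment> \<open>Exact convexity defect of the square: t (1 - t) (u - v)^2 = (1 - t) u^2 + t
        v^2 - ((1 - t) u + t v)^2. Summed with weights it is the convexity defect of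
        \<open>f\<close>.\<close>
      have strict: "t * (1 - t) * ((1 / 2) ^ k * (e k y - e k z)\<^sup>2) =
          (1 - t) * ((1 / 2) ^ k * (e k y)\<^sup>2) + t * ((1 / 2) ^ k * (e k z)\<^sup>2) - (1 / 2) ^ k * (e k x)\<^sup>2" for k
        unfolding ex by (simp add: power2_eq_square algebra_simps)
      have fs: "(\<lambda>k. (1 / 2) ^ k * (e k w)\<^sup>2) sums f w" if "w \<in> K" for w
        unfolding f_def using fsum[OF that] by (rule summable_sums)
      have D: "(\<lambda>k. t * (1 - t) * ((1 / 2) ^ k * (e k y - e k z)\<^sup>2)) sums ((1 - t) * f y + t * f z - f x)"
        unfolding strict by (intro sums_diff sums_add sums_mult fs y z elim)
      have hx: "h n x = (1 - t) * h n y + t * h n z" for n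
        unfolding h_def ex by (simp add: algebra_simps sum.distrib sum_distrib_left sum_subtractf)
      \<comment> \<open>As \<open>h\<close> is affine, the mean of \<open>g\<close> over
        \<open>y\<close> and \<open>z\<close> is \<open>g\<close> at \<open>x\<close> minus the
        convexity defect of \<open>f\<close>; it is nonnegative, so the defect is bounded by a
        quantity tending to 0.\<close>
      have "(1 - t) * f y + t * f z - f x \<le> g (s n) x" for n
      proof -
        have "0 \<le> (1 - t) * g (s n) y + t * g (s n) z"
          using t g0[OF y] g0[OF z] by (intro add_nonneg_nonneg mult_nonneg_nonneg) auto
        moreover define \<delta> where "\<delta> = 5 / real (Suc (r (s n)))"
        ultimately show ?thesis
          unfolding g_def hx \<delta>_def[symmetric] by (simp add: algebra_simps)
      qed
      with elim(1) have "(1 - t) * f y + t * f z - f x \<le> 0"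
        by (intro LIMSEQ_le_const) auto
      have nn: "0 \<le> t * (1 - t) * ((1 / 2) ^ k * (e k y - e k z)\<^sup>2)" for k
        using t by simp
      have "(\<Sum>k. t * (1 - t) * ((1 / 2) ^ k * (e k y - e k z)\<^sup>2)) = 0"
        using D \<open>_ \<le> 0\<close> suminf_nonneg[OF sums_summable[OF D] nn] by (simp add: sums_iff)
      then have "\<forall>k. t * (1 - t) * ((1 / 2) ^ k * (e k y - e k z)\<^sup>2) = 0"
        using suminf_eq_zero_iff[OF sums_summable[OF D] nn] by simp
      then have eyz: "e k y = e k z" for k using t by simp
      then have "y = z" by (rule sep[OF y z])
      moreover have "y = x"
        by (rule sep[OF y elim(2)]) (simp add: ex eyz algebra_simps)
      ultimately show "y = x \<and> z = x" by simp
    qed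
  qed
  with \<mu> bary show ?thesis by (rule that)
qed

section \<open>Choquet measures on the state space\<close>

lemma star_one: "star (1 :: 'a::cstar_algebra) = 1"
  by (metis mult_1_left mult_1_right star_mult star_star)

lemma states_D:
  assumes "\<phi> \<in> states"
  shows "bounded_linear \<phi>" "\<phi> (a + b) = \<phi> a + \<phi> b" "\<phi> (c *\<^sub>C a) = c * \<phi> a"
    "Re (\<phi> (star a * a)) \<ge> 0" "Im (\<phi> (star a * a)) = 0" "\<phi> 1 = 1"
  using assms by (auto simp: states_def complex_nonneg_Reals_iff linear_simps(1))

lemma star_mult_add_scaleC_one:
  "star (a + c *\<^sub>C 1) * (a + c *\<^sub>C 1) =
    star a * a + c *\<^sub>C star a + cnj c *\<^sub>C a + (cnj c * c) *\<^sub>C (1 :: 'a::cstar_algebra)"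
  by (simp add: star_add star_scaleC star_one distrib_left distrib_right mult_scaleC_left
      mult_scaleC_right scaleC_scaleC scaleC_add_right add.assoc mult.commute)

text \<open>Positivity applied to a + c 1. Special values of \<open>c\<close> give both
  compatibility with the involution and the Cauchy--Schwarz inequality.\<close>

lemma state_quadratic:
  assumes "\<phi> \<in> states"
  shows "Re (\<phi> (star a * a) + c * \<phi> (star a) + cnj c * \<phi> a + cnj c * c) \<ge> 0"
    "Im (\<phi> (star a * a) + c * \<phi> (star a) + cnj c * \<phi> a + cnj c * c) = 0"
proof -
  have "\<phi> (star (a + c *\<^sub>C 1) * (a + c *\<^sub>C 1)) =
      \<phi> (star a * a) + c * \<phi> (star a) + cnj c * \<phi> a + cnj c * c"
    by (simp add: star_mult_add_scaleC_one states_D(2,3,6)[OF assms])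
  then show "Re (\<phi> (star a * a) + c * \<phi> (star a) + cnj c * \<phi> a + cnj c * c) \<ge> 0"
    "Im (\<phi> (star a * a) + c * \<phi> (star a) + cnj c * \<phi> a + cnj c * c) = 0"
    using states_D(4,5)[OF assms, of "a + c *\<^sub>C 1"] by simp_all
qed

lemma state_star:
  assumes "\<phi> \<in> states"
  shows "\<phi> (star a) = cnj (\<phi> a)"
  using state_quadratic(2)[OF assms, of a 1] state_quadratic(2)[OF assms, of a \<i>]
    states_D(5)[OF assms, of a]
  by (simp add: complex_eq_iff)

text \<open>The choice c = -\<phi>(a) reduces the quadratic expression to \<phi>(a* a) -
  |\<phi>(a)|^2.\<close>

lemma state_Cauchy_Schwarz:
  assumes "\<phi> \<in> states"
  shows "(cmod (\<phi> a))\<^sup>2 \<le> cmod (\<phi> (star a * a))"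
proof -
  have "0 \<le> Re (\<phi> (star a * a)) - (cmod (\<phi> a))\<^sup>2"
    unfolding cmod_power2 using state_quadratic(1)[OF assms, of a "- \<phi> a"]
    by (simp add: state_star[OF assms] power2_eq_square algebra_simps)
  then show ?thesis using complex_Re_le_cmod[of "\<phi> (star a * a)"] by linarith
qed

text \<open>By the Cauchy--Schwarz inequality the operator norm \<open>B\<close> of a state satisfies
  \<open>B\<^sup>2 \<le> B\<close>.\<close>

lemma state_norm_le:
  fixes \<phi> :: "'a::cstar_algebra \<Rightarrow> complex"
  assumes "\<phi> \<in> states"
  shows "cmod (\<phi> a) \<le> norm a"
proof -
  have bl: "bounded_linear \<phi>" by (rule states_D(1)[OF assms])
  define B where "B = onorm \<phi>"
  have B0: "0 \<le> B" unfolding B_def by (rule onorm_pos_le[OF bl])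
  have "cmod (\<phi> x) \<le> sqrt B * norm x" for x
  proof (rule power2_le_imp_le)
    have "(cmod (\<phi> x))\<^sup>2 \<le> B * norm (star x * x)"
      using state_Cauchy_Schwarz[OF assms, of x] onorm[OF bl, of "star x * x"] by (simp add: B_def)
    then show "(cmod (\<phi> x))\<^sup>2 \<le> (sqrt B * norm x)\<^sup>2"
      using B0 by (simp add: cstar_identity power_mult_distrib)
  qed (use B0 in simp)
  then have "onorm \<phi> \<le> sqrt B" using B0 by (intro onorm_bound) auto
  then have "B\<^sup>2 \<le> B" using power_mono[of B "sqrt B" 2] B0 by (simp add: B_def)
  then have "B \<le> 1" using B0 by (cases "B = 0") (simp_all add: power2_eq_square mult_le_cancel_left2)
  then have "B * norm a \<le> norm a" by (simp add: mult_left_le_one_le B0)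
  then show ?thesis using onorm[OF bl, of a] by (simp add: B_def)
qed

text \<open>Banach--Alaoglu argument. Boundedness is not a pointwise closed condition, but the norm
  bound trades it for membership in a product of discs of radius \<open>norm a\<close>, compact by
  Tychonoff; what remains is closed for pointwise convergence.\<close>

lemma compact_states: "compact (states :: ('a::cstar_algebra \<Rightarrow> complex) set)"
proof -
  let ?L = "{\<phi> :: 'a \<Rightarrow> complex. (\<forall>a b. \<phi> (a + b) = \<phi> a + \<phi> b) \<and>
    (\<forall>c a. \<phi> (c *\<^sub>C a) = c * \<phi> a) \<and>
    (\<forall>a. 0 \<le> Re (\<phi> (star a * a)) \<and> Im (\<phi> (star a * a)) = 0) \<and> \<phi> 1 = 1}"
  have states_eq: "states = Pi UNIV (\<lambda>a. cball 0 (norm a)) \<inter> ?L"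
  proof (intro equalityI subsetI)
    fix \<phi> :: "'a \<Rightarrow> complex" assume "\<phi> \<in> states"
    then show "\<phi> \<in> Pi UNIV (\<lambda>a. cball 0 (norm a)) \<inter> ?L"
      by (auto simp: states_D state_norm_le)
  next
    fix \<phi> assume \<phi>: "\<phi> \<in> Pi UNIV (\<lambda>a. cball 0 (norm a)) \<inter> ?L"
    then have "bounded_linear \<phi>"
      by (intro bounded_linear_intro[of _ 1])
        (auto simp: scaleR_scaleC scaleR_conv_of_real Pi_def)
    with \<phi> show "\<phi> \<in> states" by (auto simp: states_def complex_nonneg_Reals_iff)
  qed
  have "closed ?L"
    by (intro closed_Collect_conj closed_Collect_all closed_Collect_eq closed_Collect_le
        continuous_intros continuous_on_product_coordinates)
  moreover have "compact (Pi UNIV (\<lambda>a :: 'a. cball (0 :: complex) (norm a)))"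
    by (rule compact_Pi) simp
  ultimately show ?thesis unfolding states_eq by (intro compact_Int_closed)
qed

section \<open>Evaluation at a dense sequence as coordinates on the state space\<close>

lemma measurable_state_eval:
  assumes "sets \<mu> = sets state_borel"
  shows "(\<lambda>\<alpha>. \<alpha> a) \<in> borel_measurable \<mu>"
proof -
  have "(\<lambda>\<alpha>. \<alpha> a) \<in> borel_measurable state_borel" unfolding state_borel_def
    by (intro measurable_restrict_space1 borel_measurable_continuous_onI) simp
  then show ?thesis by (simp cong: measurable_cong_sets add: assms)
qed

theorem Choquet_states:
  fixes \<phi> :: "'a::cstar_algebra \<Rightarrow> complex"
  assumes separable: "\<exists>D::'a set. countable D \<and> closure D = UNIV"
    and \<phi>: "\<phi> \<in> states"
  obtains \<mu> where "borel_prob_on_states \<mu>" "barycenter \<mu> = \<phi>" "AE \<alpha> in \<mu>. pure_state \<alpha>"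
proof -
  obtain D :: "'a set" where D: "countable D" "closure D = UNIV" using separable by blast
  then have "D \<noteq> {}" by auto
  define d where "d = from_nat_into D"
  have d: "range d = D" unfolding d_def by (rule range_from_nat_into[OF \<open>D \<noteq> {}\<close> D(1)])
  \<comment> \<open>Scales the coordinates into [-1, 1], since a state has norm at most 1; the
    summand 1 keeps the denominator positive.\<close>
  define s where "s k = 1 / (1 + norm (d k))" for k
  have s0: "0 < s k" for k unfolding s_def by (simp add: add_pos_nonneg)
  \<comment> \<open>Real parts sit at even indices and imaginary parts at odd ones, because the
    coordinates have to be real.\<close>
  define e where "e j \<alpha> = s (j div 2) * (if even j then Re (\<alpha> (d (j div 2))) else Im (\<alpha> (d (j div 2))))"
    for j and \<alpha> :: "'a \<Rightarrow> complex"
  have e_even: "e (2 * k) \<alpha> = s k * Re (\<alpha> (d k))" and e_odd: "e (2 * k + 1) \<alpha> = s k * Im (\<alpha> (d k))"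
    for k \<alpha> by (simp_all add: e_def)
  \<comment> \<open>\<open>\<beta>\<close> is only asked to be continuous, because this is also
    applied to the barycenter before that is known to be a state.\<close>
  have agree: "\<alpha> = \<beta>"
    if "\<alpha> \<in> states" "continuous_on UNIV \<beta>" "\<And>k. \<alpha> (d k) = \<beta> (d k)" for \<alpha> \<beta> :: "'a \<Rightarrow> complex"
  proof
    fix a
    have "closed {a. \<alpha> a = \<beta> a}"
      using that(2) linear_continuous_on[OF states_D(1)[OF that(1)]] by (intro closed_Collect_eq) auto
    moreover have "D \<subseteq> {a. \<alpha> a = \<beta> a}" using that(3) d by auto
    ultimately have "closure D \<subseteq> {a. \<alpha> a = \<beta> a}" by (rule closure_minimal[rotated])
    then show "\<alpha> a = \<beta> a" using D(2) by auto
  qed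
  have cont_state: "continuous_on UNIV \<alpha>" if "\<alpha> \<in> states" for \<alpha> :: "'a \<Rightarrow> complex"
    by (rule linear_continuous_on[OF states_D(1)[OF that]])
  have cont: "continuous_on states (e j)" for j
    unfolding e_def
    by (cases "even j") (auto intro!: continuous_intros
        continuous_on_subset[OF continuous_on_product_coordinates])
  have bnd: "\<bar>e j \<alpha>\<bar> \<le> 1" if "\<alpha> \<in> states" for j \<alpha>
  proof -
    define a where "a = d (j div 2)"
    define u where "u = (if even j then Re (\<alpha> a) else Im (\<alpha> a))"
    have "\<bar>Re (\<alpha> a)\<bar> \<le> norm a" "\<bar>Im (\<alpha> a)\<bar> \<le> norm a"
      using abs_Re_le_cmod[of "\<alpha> a"] abs_Im_le_cmod[of "\<alpha> a"] state_norm_le[OF that, of a] by linarith+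
    then have "\<bar>u\<bar> \<le> 1 + norm a" by (simp add: u_def)
    moreover have "e j \<alpha> = u / (1 + norm a)" by (simp add: e_def s_def u_def a_def)
    moreover have "0 < 1 + norm a" by (simp add: add_pos_nonneg)
    ultimately show ?thesis by simp
  qed
  have coords: "\<alpha> (d k) = z" if "e (2 * k) \<alpha> = s k * Re z" "e (2 * k + 1) \<alpha> = s k * Im z" for \<alpha> k z
    using that s0[of k] unfolding e_even e_odd by (simp add: complex_eq_iff)
  have sep: "\<alpha> = \<beta>" if "\<alpha> \<in> states" "\<beta> \<in> states" "\<And>j. e j \<alpha> = e j \<beta>" for \<alpha> \<beta>
  proof (rule agree[OF that(1) cont_state[OF that(2)]])
    show "\<alpha> (d k) = \<beta> (d k)" for k
      using that(3)[of "2 * k"] that(3)[of "2 * k + 1"] by (intro coords) (simp_all only: e_even e_odd)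
  qed
  obtain \<mu> where \<mu>: "prob_space \<mu>" "sets \<mu> = sets (restrict_space borel states)"
    and bary: "\<And>j. (\<integral>\<alpha>. e j \<alpha> \<partial>\<mu>) = e j \<phi>"
    and extreme: "AE \<alpha> in \<mu>. \<forall>\<beta>\<in>states. \<forall>\<gamma>\<in>states. \<forall>t. 0 < t \<and> t < 1 \<and>
      (\<forall>j. e j \<alpha> = (1 - t) * e j \<beta> + t * e j \<gamma>) \<longrightarrow> \<beta> = \<alpha> \<and> \<gamma> = \<alpha>"
    by (rule Choquet_metrizable[of states e \<phi>])
      ((rule compact_states cont bnd sep \<phi> that; assumption)+)
  interpret \<mu>: prob_space \<mu> by (rule \<mu>)
  have sets: "sets \<mu> = sets state_borel" using \<mu>(2) by (simp add: state_borel_def)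
  have space: "space \<mu> = states"
    using sets_eq_imp_space_eq[OF \<mu>(2)] by (simp add: space_restrict_space)
  have int: "integrable \<mu> (\<lambda>\<alpha>. \<alpha> a)" for a
    by (rule \<mu>.integrable_const_bound[of _ "norm a"])
      (auto simp: space state_norm_le measurable_state_eval[OF sets])
  have "\<phi> = barycenter \<mu>"
  proof (rule agree[OF \<phi>])
    show "\<phi> (d k) = barycenter \<mu> (d k)" for k
    proof (rule coords)
      show "e (2 * k) \<phi> = s k * Re (barycenter \<mu> (d k))"
        using bary[of "2 * k"] integral_Re[OF int[of "d k"]] by (auto simp: e_even barycenter_def)
      show "e (2 * k + 1) \<phi> = s k * Im (barycenter \<mu> (d k))"
        using bary[of "2 * k + 1"] integral_Im[OF int[of "d k"]]
        unfolding e_odd by (auto simp: barycenter_def)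
    qed
    \<comment> \<open>The norm bound for states passes through the integral, so the barycenter is
      1-Lipschitz, hence determined by its values on the dense sequence.\<close>
    have "dist (barycenter \<mu> a) (barycenter \<mu> b) \<le> 1 * dist a b" for a b
    proof -
      have "barycenter \<mu> a - barycenter \<mu> b = (\<integral>\<alpha>. \<alpha> a - \<alpha> b \<partial>\<mu>)"
        using int by (simp add: barycenter_def)
      also have "\<dots> = (\<integral>\<alpha>. \<alpha> (a - b) \<partial>\<mu>)"
        by (rule Bochner_Integration.integral_cong)
          (auto simp: space linear_simps(2)[OF states_D(1)])
      also have "cmod \<dots> \<le> (\<integral>\<alpha>. cmod (\<alpha> (a - b)) \<partial>\<mu>)"
        by (rule integral_norm_bound)
      also have "\<dots> \<le> norm (a - b)"
        using int by (intro \<mu>.integral_le_const) (auto simp: space state_norm_le)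
      finally show ?thesis by (simp add: dist_norm)
    qed
    then have "1-lipschitz_on UNIV (barycenter \<mu>)" by (intro lipschitz_onI) auto
    then show "continuous_on UNIV (barycenter \<mu>)" by (rule lipschitz_on_continuous_on)
  qed
  moreover have "AE \<alpha> in \<mu>. pure_state \<alpha>"
    using extreme AE_space
  proof eventually_elim
    case (elim \<alpha>)
    show ?case
      unfolding pure_state_def
    proof (intro conjI ballI allI impI)
      show "\<alpha> \<in> states" using elim(2) by (simp add: space)
      fix \<beta> \<gamma> :: "'a \<Rightarrow> complex" and t :: real
      assume "\<beta> \<in> states" "\<gamma> \<in> states" and t: "0 < t \<and> t < 1 \<and>
        (\<forall>a. \<alpha> a = complex_of_real (1 - t) * \<beta> a + complex_of_real t * \<gamma> a)"
      \<comment> \<open>Each coordinate is real linear in the functional, so a convex decomposition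
        of states is one of coordinates.\<close>
      moreover have "e j \<alpha> = (1 - t) * e j \<beta> + t * e j \<gamma>" for j
      proof -
        have eq: "\<alpha> (d (j div 2)) =
            complex_of_real (1 - t) * \<beta> (d (j div 2)) + complex_of_real t * \<gamma> (d (j div 2))"
          using t by blast
        show ?thesis unfolding e_def eq by (simp add: algebra_simps)
      qed
      ultimately show "\<beta> = \<alpha>" "\<gamma> = \<alpha>" using elim(1) by blast+
    qed
  qed
  ultimately show ?thesis using that \<mu>(1) sets by (simp add: borel_prob_on_states_def)
qed

section \<open>Testing the subdivision relation on a Choquet measure\<close>

theorem proposition4p6:
  fixes S :: "'a::cstar_algebra set"
  assumes separable: "\<exists>D::'a set. countable D \<and> closure D = UNIV"
    and S: "operator_system S"
    and generates: "cstar_generated S = UNIV"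
    and pure_maximal: "\<And>\<phi>. pure_state \<phi> \<Longrightarrow> maximal_state (dilation_le S) \<phi>"
  shows "\<forall>\<phi>\<in>states. maximal_state (isd_le S) \<phi>"
  unfolding maximal_state_def
proof (intro ballI conjI impI)
  fix \<phi> \<psi> :: "'a \<Rightarrow> complex"
  assume \<phi>: "\<phi> \<in> states" and "\<psi> \<in> states" and le: "isd_le S \<phi> \<psi>"
  \<comment> \<open>\<open>isd_le\<close> quantifies over all measures representing \<phi>, so it
    may be used with one carried by pure states.\<close>
  obtain \<mu> where \<mu>: "borel_prob_on_states \<mu>" "barycenter \<mu> = \<phi>" "AE \<alpha> in \<mu>. pure_state \<alpha>"
    by (rule Choquet_states[OF separable \<phi>])
  from le \<mu>(1,2) obtain \<Psi> where \<Psi>: "\<forall>\<alpha>\<in>states. \<Psi> \<alpha> \<in> states"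
    "\<forall>a. (\<lambda>\<alpha>. \<Psi> \<alpha> a) \<in> borel_measurable (completion \<mu>)"
    "AE \<alpha> in completion \<mu>. dilation_le S \<alpha> (\<Psi> \<alpha>)"
    "\<forall>a. \<psi> a = (\<integral>\<alpha>. \<Psi> \<alpha> a \<partial>completion \<mu>)"
    unfolding isd_le_def by blast
  have meas: "(\<lambda>\<alpha>. \<alpha> a) \<in> borel_measurable \<mu>" for a
    using \<mu>(1) by (intro measurable_state_eval) (simp add: borel_prob_on_states_def)
  have "AE \<alpha> in completion \<mu>. \<Psi> \<alpha> = \<alpha>"
    using \<Psi>(3) AE_completion[OF \<mu>(3)]
  proof eventually_elim
    case (elim \<alpha>)
    then show ?case
      using pure_maximal[of \<alpha>] \<Psi>(1) by (simp add: maximal_state_def)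
  qed
  then have "\<psi> a = \<phi> a" for a
  proof -
    have "\<psi> a = (\<integral>\<alpha>. \<Psi> \<alpha> a \<partial>completion \<mu>)" using \<Psi>(4) by blast
    also have "\<dots> = (\<integral>\<alpha>. \<alpha> a \<partial>completion \<mu>)"
    proof (rule integral_cong_AE)
      show "AE \<alpha> in completion \<mu>. \<Psi> \<alpha> a = \<alpha> a"
        using \<open>AE \<alpha> in completion \<mu>. \<Psi> \<alpha> = \<alpha>\<close> by eventually_elim simp
    qed (use \<Psi>(2) measurable_completion[OF meas] in auto)
    also have "\<dots> = (\<integral>\<alpha>. \<alpha> a \<partial>\<mu>)" by (rule integral_completion[OF meas])
    also have "\<dots> = \<phi> a" using \<mu>(2) by (simp add: barycenter_def fun_eq_iff)
    finally show ?thesis .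
  qed
  then show "\<psi> = \<phi>" by (rule ext)
qed

end
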